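(* Let $b\in\mathscr S_d(\mathcal J,\mathcal K)$ be a Schur-class function with $b(0)=0$ and let $X$ be an extremal Gleason solution for $\mathscr H(b)$ (so $X$ is a row partial isometry). Then $X$ acts as multiplication by $z=(z_1,\dots,z_d)$ on its initial space: for every $\mathbf f=(f_1,\dots,f_d)^T\in\mathrm{Ker}(X)^\perp\subseteq\mathscr H(b)\otimes\mathbb C^d$ and every $z\in\mathbb B^d$, $$(X\mathbf f)(z)=z_1f_1(z)+\cdots+z_df_d(z).$$
   Context: Hilbert spaces are complex and separable (or finite-dimensional); $\mathbb B^d$ is the open unit ball of $\mathbb C^d$; $zw^*:=\sum_jz_j\overline{w_j}$. $H^2_d$ is the Drury-Arveson space (kernel $1/(1-zw^* )$ on $\mathbb B^d$); $\mathscr S_d(\mathcal J,\mathcal K)$ is the set of contractive multipliers from $H^2_d\otimes\mathcal J$ to $H^2_d\otimes\mathcal K$. For $b\in\mathscr S_d(\mathcal J,\mathcal K)$, $\mathscr H(b)$ is the $\mathcal K$-valued RKHS on $\mathbb B^d$ with kernel $k^b(z,w)=\frac{I-b(z)b(w)^*}{1-zw^*}$, and $k_z^b\in\mathscr L(\mathcal K,\mathscr H(b))$ is the adjoint of evaluation at $z$. A row contraction $X=(X_1,\dots,X_d):\mathscr H(b)\otimes\mathbb C^d\to\mathscr H(b)$ is a Gleason solution for $\mathscr H(b)$ if $\sum_jz_j(X_j^*f)(z)=f(z)-f(0)$ for all $f\in\mathscr H(b)$, $z\in\mathbb B^d$; it is extremal if $XX^*=I-k_0^b(k_0^b)^*$.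 *)

theory Defs
  imports "HOL-Analysis.Analysis" "HOL-Library.Function_Algebras"
begin

section \<open>Complex Hilbert spaces on explicit carriers\<close>

class complex_vector = ab_group_add +
  fixes scaleC :: "complex \<Rightarrow> 'a \<Rightarrow> 'a"  (infixr "*\<^sub>C" 75)
  assumes scaleC_add_right: "a *\<^sub>C (x + y) = a *\<^sub>C x + a *\<^sub>C y"
    and scaleC_add_left: "(a + b) *\<^sub>C x = a *\<^sub>C x + b *\<^sub>C x"
    and scaleC_scaleC: "a *\<^sub>C (b *\<^sub>C x) = (a * b) *\<^sub>C x"
    and scaleC_one: "1 *\<^sub>C x = x"

instantiation "fun" :: (type, complex_vector) complex_vector
begin

definition scaleC_fun :: "complex \<Rightarrow> ('a \<Rightarrow> 'b) \<Rightarrow> 'a \<Rightarrow> 'b" where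
  "scaleC_fun a f = (\<lambda>z. a *\<^sub>C f z)"

instance
  by standard
    (simp_all add: scaleC_fun_def fun_eq_iff scaleC_add_right scaleC_add_left
      scaleC_scaleC scaleC_one)

end

text \<open>A reproducing kernel Hilbert space is a linear space of functions with an inner product of
  its own, so a Hilbert space is given by a subspace of an ambient vector space together with an
  inner product. The values of the inner product outside the carrier are irrelevant.\<close>

record 'a hspace =
  hcarrier :: "'a set"
  hinner :: "'a \<Rightarrow> 'a \<Rightarrow> complex"

definition hnorm :: "'a hspace \<Rightarrow> 'a \<Rightarrow> real" where
  "hnorm H x = sqrt (Re (hinner H x x))"

text \<open>Inner products are linear in the first argument.\<close>

locale hilbert_space =
  fixes H :: "'a::complex_vector hspace"
  assumes zero_closed: "0 \<in> hcarrier H"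
    and add_closed: "\<lbrakk>x \<in> hcarrier H; y \<in> hcarrier H\<rbrakk> \<Longrightarrow> x + y \<in> hcarrier H"
    and scaleC_closed: "x \<in> hcarrier H \<Longrightarrow> a *\<^sub>C x \<in> hcarrier H"
    and inner_commute:
      "\<lbrakk>x \<in> hcarrier H; y \<in> hcarrier H\<rbrakk> \<Longrightarrow> hinner H x y = cnj (hinner H y x)"
    and inner_add_left:
      "\<lbrakk>x \<in> hcarrier H; y \<in> hcarrier H; u \<in> hcarrier H\<rbrakk>
        \<Longrightarrow> hinner H (x + y) u = hinner H x u + hinner H y u"
    and inner_scaleC_left:
      "\<lbrakk>x \<in> hcarrier H; u \<in> hcarrier H\<rbrakk> \<Longrightarrow> hinner H (a *\<^sub>C x) u = a * hinner H x u"
    and inner_nonneg: "x \<in> hcarrier H \<Longrightarrow> 0 \<le> Re (hinner H x x)"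
    and inner_eq_zero: "\<lbrakk>x \<in> hcarrier H; hinner H x x = 0\<rbrakk> \<Longrightarrow> x = 0"
    and complete:
      "\<lbrakk>\<And>n. s n \<in> hcarrier H;
        \<And>e. e > 0 \<Longrightarrow> \<exists>N. \<forall>m\<ge>N. \<forall>n\<ge>N. hnorm H (s m - s n) < e\<rbrakk>
        \<Longrightarrow> \<exists>x\<in>hcarrier H. (\<lambda>n. hnorm H (s n - x)) \<longlonglongrightarrow> 0"

definition hseparable :: "'a::complex_vector hspace \<Rightarrow> bool" where
  "hseparable H \<longleftrightarrow>
    (\<exists>D. countable D \<and> D \<subseteq> hcarrier H \<and>
      (\<forall>x\<in>hcarrier H. \<forall>e>0. \<exists>y\<in>D. hnorm H (x - y) < e))"

definition bounded_op ::
  "'a::complex_vector hspace \<Rightarrow> 'b::complex_vector hspace \<Rightarrow> ('a \<Rightarrow> 'b) \<Rightarrow> bool" where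
  "bounded_op H K T \<longleftrightarrow>
    (\<forall>x\<in>hcarrier H. T x \<in> hcarrier K) \<and>
    (\<forall>x\<in>hcarrier H. \<forall>y\<in>hcarrier H. T (x + y) = T x + T y) \<and>
    (\<forall>a. \<forall>x\<in>hcarrier H. T (a *\<^sub>C x) = a *\<^sub>C T x) \<and>
    (\<exists>C. \<forall>x\<in>hcarrier H. hnorm K (T x) \<le> C * hnorm H x)"

definition contractive_op ::
  "'a::complex_vector hspace \<Rightarrow> 'b::complex_vector hspace \<Rightarrow> ('a \<Rightarrow> 'b) \<Rightarrow> bool" where
  "contractive_op H K T \<longleftrightarrow>
    bounded_op H K T \<and> (\<forall>x\<in>hcarrier H. hnorm K (T x) \<le> hnorm H x)"

text \<open>The adjoint is only meaningful on the carrier of the second space, for bounded operators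
  between Hilbert spaces; there the Riesz theorem gives the unique vector described.\<close>

definition hadj ::
  "'a hspace \<Rightarrow> 'b hspace \<Rightarrow> ('a \<Rightarrow> 'b) \<Rightarrow> 'b \<Rightarrow> 'a" where
  "hadj H K T y =
    (THE x. x \<in> hcarrier H \<and> (\<forall>u\<in>hcarrier H. hinner K (T u) y = hinner H u x))"

definition hker :: "'a hspace \<Rightarrow> ('a \<Rightarrow> 'b::zero) \<Rightarrow> 'a set" where
  "hker H T = {x \<in> hcarrier H. T x = 0}"

definition hperp :: "'a hspace \<Rightarrow> 'a set \<Rightarrow> 'a set" where
  "hperp H S = {x \<in> hcarrier H. \<forall>y\<in>S. hinner H x y = 0}"

definition partial_isometry ::
  "'a::complex_vector hspace \<Rightarrow> 'b::complex_vector hspace \<Rightarrow> ('a \<Rightarrow> 'b) \<Rightarrow> bool" where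
  "partial_isometry H K T \<longleftrightarrow>
    bounded_op H K T \<and> (\<forall>x\<in>hperp H (hker H T). hnorm K (T x) = hnorm H x)"

text \<open>The space \<open>H \<otimes> \<complex>\<^sup>d\<close>, as the space of \<open>d\<close>-tuples of elements of \<open>H\<close>.\<close>

definition htuple :: "'a hspace \<Rightarrow> ('d::finite \<Rightarrow> 'a) hspace" where
  "htuple H = \<lparr>hcarrier = {F. \<forall>j. F j \<in> hcarrier H},
               hinner = (\<lambda>F G. \<Sum>j\<in>UNIV. hinner H (F j) (G j))\<rparr>"

definition row_op :: "('d::finite \<Rightarrow> 'a \<Rightarrow> 'a) \<Rightarrow> ('d \<Rightarrow> 'a) \<Rightarrow> 'a::complex_vector" where
  "row_op X F = (\<Sum>j\<in>UNIV. X j (F j))"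


section \<open>Vector-valued reproducing kernel Hilbert spaces on the ball\<close>

abbreviation unit_ball :: "(complex ^ 'd::finite) set"  ("\<bool>") where
  "\<bool> \<equiv> ball 0 1"

definition herm :: "complex ^ 'd::finite \<Rightarrow> complex ^ 'd \<Rightarrow> complex" where
  "herm z w = (\<Sum>j\<in>UNIV. z $ j * cnj (w $ j))"

text \<open>A function on the ball is represented by its extension by zero to the whole space.\<close>

definition on_ball :: "(complex ^ 'd::finite \<Rightarrow> 'a) \<Rightarrow> complex ^ 'd \<Rightarrow> 'a::complex_vector" where
  "on_ball f = (\<lambda>z. if z \<in> \<bool> then f z else 0)"

text \<open>\<open>H\<close> is the \<open>K\<close>-valued reproducing kernel Hilbert space on the ball with the operator-valued
  kernel \<open>k\<close>. This determines the carrier of \<open>H\<close> and the inner product on it.\<close>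

definition is_rkhs ::
  "'k::complex_vector hspace \<Rightarrow> (complex ^ 'd::finite \<Rightarrow> complex ^ 'd \<Rightarrow> 'k \<Rightarrow> 'k) \<Rightarrow>
    (complex ^ 'd \<Rightarrow> 'k) hspace \<Rightarrow> bool" where
  "is_rkhs K k H \<longleftrightarrow>
    hilbert_space H \<and>
    (\<forall>f\<in>hcarrier H. (\<forall>z\<in>\<bool>. f z \<in> hcarrier K) \<and> (\<forall>z. z \<notin> \<bool> \<longrightarrow> f z = 0)) \<and>
    (\<forall>w\<in>\<bool>. \<forall>x\<in>hcarrier K.
      on_ball (\<lambda>z. k z w x) \<in> hcarrier H \<and>
      (\<forall>f\<in>hcarrier H. hinner H f (on_ball (\<lambda>z. k z w x)) = hinner K (f w) x))"

text \<open>The operator usually written \<open>k\<^sub>z\<close>, from \<open>K\<close> to \<open>H\<close>.\<close>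

definition kernel_op ::
  "'k hspace \<Rightarrow> (complex ^ 'd::finite \<Rightarrow> 'k) hspace \<Rightarrow> complex ^ 'd \<Rightarrow> 'k \<Rightarrow> complex ^ 'd \<Rightarrow> 'k" where
  "kernel_op K H z = hadj H K (\<lambda>f. f z)"


section \<open>Schur class, de Branges--Rovnyak spaces, Gleason solutions\<close>

text \<open>The space \<open>H\<^sup>2\<^sub>d \<otimes> K\<close> is the \<open>K\<close>-valued reproducing kernel Hilbert space of the kernel
  \<open>I / (1 - z w\<^sup>*)\<close>.\<close>

definition drury_arveson_kernel ::
  "complex ^ 'd::finite \<Rightarrow> complex ^ 'd \<Rightarrow> 'k \<Rightarrow> 'k::complex_vector" where
  "drury_arveson_kernel z w x = (1 / (1 - herm z w)) *\<^sub>C x"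

definition is_drury_arveson ::
  "'k::complex_vector hspace \<Rightarrow> (complex ^ 'd::finite \<Rightarrow> 'k) hspace \<Rightarrow> bool" where
  "is_drury_arveson K H \<longleftrightarrow> is_rkhs K drury_arveson_kernel H"

text \<open>The spaces \<open>H\<^sub>J\<close> and \<open>H\<^sub>K\<close> are determined by their kernels, so the existential quantifiers
  only give them names.\<close>

definition schur_class ::
  "'j::complex_vector hspace \<Rightarrow> 'k::complex_vector hspace \<Rightarrow>
    (complex ^ 'd::finite \<Rightarrow> 'j \<Rightarrow> 'k) \<Rightarrow> bool" where
  "schur_class J K b \<longleftrightarrow>
    (\<forall>z\<in>\<bool>. bounded_op J K (b z)) \<and>
    (\<exists>H\<^sub>J H\<^sub>K. is_drury_arveson J H\<^sub>J \<and> is_drury_arveson K H\<^sub>K \<and>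
      contractive_op H\<^sub>J H\<^sub>K (\<lambda>f. on_ball (\<lambda>z. b z (f z))))"

definition dBR_kernel ::
  "'j::complex_vector hspace \<Rightarrow> 'k::complex_vector hspace \<Rightarrow>
    (complex ^ 'd::finite \<Rightarrow> 'j \<Rightarrow> 'k) \<Rightarrow> complex ^ 'd \<Rightarrow> complex ^ 'd \<Rightarrow> 'k \<Rightarrow> 'k" where
  "dBR_kernel J K b z w x =
    (1 / (1 - herm z w)) *\<^sub>C (x - b z (hadj J K (b w) x))"

definition is_dBR_space ::
  "'j::complex_vector hspace \<Rightarrow> 'k::complex_vector hspace \<Rightarrow>
    (complex ^ 'd::finite \<Rightarrow> 'j \<Rightarrow> 'k) \<Rightarrow> (complex ^ 'd \<Rightarrow> 'k) hspace \<Rightarrow> bool" where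
  "is_dBR_space J K b H \<longleftrightarrow> is_rkhs K (dBR_kernel J K b) H"

definition row_contraction ::
  "'a::complex_vector hspace \<Rightarrow> ('d::finite \<Rightarrow> 'a \<Rightarrow> 'a) \<Rightarrow> bool" where
  "row_contraction H X \<longleftrightarrow>
    (\<forall>j. bounded_op H H (X j)) \<and> contractive_op (htuple H) H (row_op X)"

definition gleason_solution ::
  "(complex ^ 'd::finite \<Rightarrow> 'k::complex_vector) hspace \<Rightarrow>
    ('d \<Rightarrow> (complex ^ 'd \<Rightarrow> 'k) \<Rightarrow> complex ^ 'd \<Rightarrow> 'k) \<Rightarrow> bool" where
  "gleason_solution H X \<longleftrightarrow>
    row_contraction H X \<and>
    (\<forall>f\<in>hcarrier H. \<forall>z\<in>\<bool>.
      (\<Sum>j\<in>UNIV. z $ j *\<^sub>C hadj H H (X j) f z) = f z - f 0)"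

text \<open>\<open>X X\<^sup>* = I - k\<^sub>0 k\<^sub>0\<^sup>*\<close>\<close>

definition extremal_gleason_solution ::
  "'k::complex_vector hspace \<Rightarrow> (complex ^ 'd::finite \<Rightarrow> 'k) hspace \<Rightarrow>
    ('d \<Rightarrow> (complex ^ 'd \<Rightarrow> 'k) \<Rightarrow> complex ^ 'd \<Rightarrow> 'k) \<Rightarrow> bool" where
  "extremal_gleason_solution K H X \<longleftrightarrow>
    gleason_solution H X \<and>
    (\<forall>f\<in>hcarrier H.
      row_op X (hadj (htuple H) H (row_op X) f) =
        f - kernel_op K H 0 (hadj K H (kernel_op K H 0) f))"

end

theory Submission
  imports Defs
begin

text \<open>Since \<open>b 0 = 0\<close>, the kernel at \<open>0\<close> is \<open>k\<^sub>0 x = x\<close> (a constant function), so extremality says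
  \<open>X X\<^sup>* f = f - f 0\<close>. In particular \<open>X\<^sup>*\<close> kills the constants \<open>k\<^sub>0 x\<close>, hence \<open>X F\<close> vanishes at \<open>0\<close>
  for every \<open>F\<close>, and \<open>X X\<^sup>* X = X\<close>. For \<open>F\<close> orthogonal to the kernel of \<open>X\<close> this gives
  \<open>F = X\<^sup>* X F\<close>, so \<open>X\<close> is isometric there, and the Gleason identity applied to \<open>X F\<close> reads
  \<open>(X F) z = \<Sum>\<^sub>j z\<^sub>j (X\<^sub>j\<^sup>* X F) z = \<Sum>\<^sub>j z\<^sub>j F\<^sub>j z\<close>.\<close>

section \<open>Elementary algebra of scalars and real quadratics\<close>

lemma scaleC_zero_left [simp]: "0 *\<^sub>C (x::'a::complex_vector) = 0"
  using scaleC_add_left[of 0 0 x] by simp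

lemma scaleC_zero_right [simp]: "a *\<^sub>C (0::'a::complex_vector) = 0"
  using scaleC_add_right[of a 0 "0::'a"] by simp

lemma scaleC_minus_one: "(-1) *\<^sub>C (x::'a::complex_vector) = - x"
proof -
  have "(-1) *\<^sub>C x + x = 0"
    using scaleC_add_left[of "-1" 1 x] by (simp add: scaleC_one)
  then show ?thesis by (simp add: eq_neg_iff_add_eq_0)
qed

text \<open>First-order condition at a minimum, used for the variational step in
  \<open>riesz\<close>. Testing \<open>t = - r / (q + 1)\<close> instead of the minimiser
  \<open>- r / q\<close> keeps the denominator positive when \<open>q = 0\<close>, and the value
  there is still negative unless \<open>r = 0\<close>.\<close>

lemma quadratic_nonneg_imp_zero:
  fixes r q :: real
  assumes "\<And>t. 0 \<le> 2 * t * r + t\<^sup>2 * q" "0 \<le> q"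
  shows "r = 0"
proof -
  have "0 \<le> 2 * (- r / (q + 1)) * r + (- r / (q + 1))\<^sup>2 * q" by (rule assms)
  also have "\<dots> = - (r\<^sup>2 * (q + 2) / (q + 1)\<^sup>2)"
    using assms(2) by (simp add: divide_simps power2_eq_square) (simp add: algebra_simps)
  finally have "r\<^sup>2 * (q + 2) / (q + 1)\<^sup>2 \<le> 0" by simp
  then show ?thesis
    using assms(2) by (auto simp: divide_le_0_iff mult_le_0_iff)
qed

section \<open>Inner product geometry, Riesz representation and adjoints\<close>

context hilbert_space
begin

lemma minus_closed: "x \<in> hcarrier H \<Longrightarrow> - x \<in> hcarrier H"
  using scaleC_closed[of x "-1"] by (simp add: scaleC_minus_one)

lemma diff_closed: "x \<in> hcarrier H \<Longrightarrow> y \<in> hcarrier H \<Longrightarrow> x - y \<in> hcarrier H"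
  using add_closed[of x "- y"] minus_closed by simp

lemma inner_minus_left:
  "x \<in> hcarrier H \<Longrightarrow> u \<in> hcarrier H \<Longrightarrow> hinner H (- x) u = - hinner H x u"
  using inner_scaleC_left[of x u "-1"] by (simp add: scaleC_minus_one)

lemma inner_diff_left:
  "\<lbrakk>x \<in> hcarrier H; y \<in> hcarrier H; u \<in> hcarrier H\<rbrakk>
    \<Longrightarrow> hinner H (x - y) u = hinner H x u - hinner H y u"
  using inner_add_left[of x "- y" u] by (simp add: minus_closed inner_minus_left)

lemma inner_zero_left [simp]: "u \<in> hcarrier H \<Longrightarrow> hinner H 0 u = 0"
  using inner_scaleC_left[of 0 u 0] zero_closed by simp

lemma inner_zero_right [simp]: "u \<in> hcarrier H \<Longrightarrow> hinner H u 0 = 0"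
  using inner_commute[of u 0] zero_closed by simp

lemma inner_add_right:
  "\<lbrakk>x \<in> hcarrier H; y \<in> hcarrier H; u \<in> hcarrier H\<rbrakk>
    \<Longrightarrow> hinner H u (x + y) = hinner H u x + hinner H u y"
  using inner_commute[of u] by (simp add: add_closed inner_add_left)

lemma inner_scaleC_right:
  "\<lbrakk>x \<in> hcarrier H; u \<in> hcarrier H\<rbrakk> \<Longrightarrow> hinner H u (a *\<^sub>C x) = cnj a * hinner H u x"
  using inner_commute[of u] by (simp add: scaleC_closed inner_scaleC_left)

lemma inner_diff_right:
  "\<lbrakk>x \<in> hcarrier H; y \<in> hcarrier H; u \<in> hcarrier H\<rbrakk>
    \<Longrightarrow> hinner H u (x - y) = hinner H u x - hinner H u y"
  using inner_commute[of u] by (simp add: diff_closed inner_diff_left)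

lemma Re_inner_commute:
  "\<lbrakk>x \<in> hcarrier H; y \<in> hcarrier H\<rbrakk> \<Longrightarrow> Re (hinner H x y) = Re (hinner H y x)"
  using inner_commute[of x y] by simp

lemma inner_self_eq: "x \<in> hcarrier H \<Longrightarrow> hinner H x x = of_real (Re (hinner H x x))"
  using inner_commute[of x x] by (simp add: complex_eq_iff)

lemma hnorm_nonneg: "x \<in> hcarrier H \<Longrightarrow> 0 \<le> hnorm H x"
  by (simp add: hnorm_def inner_nonneg)

lemma hnorm_square: "x \<in> hcarrier H \<Longrightarrow> (hnorm H x)\<^sup>2 = Re (hinner H x x)"
  by (simp add: hnorm_def inner_nonneg)

lemma hnorm_add_square:
  assumes "x \<in> hcarrier H" "y \<in> hcarrier H"
  shows "(hnorm H (x + y))\<^sup>2 = (hnorm H x)\<^sup>2 + 2 * Re (hinner H x y) + (hnorm H y)\<^sup>2"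
  using assms Re_inner_commute[of y x]
  by (simp add: hnorm_square add_closed inner_add_left inner_add_right)

lemma hnorm_diff_square:
  assumes "x \<in> hcarrier H" "y \<in> hcarrier H"
  shows "(hnorm H (x - y))\<^sup>2 = (hnorm H x)\<^sup>2 - 2 * Re (hinner H x y) + (hnorm H y)\<^sup>2"
  using assms Re_inner_commute[of y x]
  by (simp add: hnorm_square diff_closed inner_diff_left inner_diff_right)

lemma hnorm_scaleC_square:
  assumes "x \<in> hcarrier H"
  shows "(hnorm H (a *\<^sub>C x))\<^sup>2 = (cmod a)\<^sup>2 * (hnorm H x)\<^sup>2"
proof -
  have "hinner H (a *\<^sub>C x) (a *\<^sub>C x) = (a * cnj a) * hinner H x x"
    using assms by (simp add: scaleC_closed inner_scaleC_left inner_scaleC_right)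
  also have "\<dots> = of_real ((cmod a)\<^sup>2) * hinner H x x"
    by (simp only: complex_norm_square)
  finally show ?thesis
    using assms by (simp add: hnorm_square scaleC_closed del: of_real_power)
qed

lemma cauchy_schwarz:
  assumes x: "x \<in> hcarrier H" and y: "y \<in> hcarrier H"
  shows "cmod (hinner H x y) \<le> hnorm H x * hnorm H y"
proof (cases "hnorm H y = 0")
  case True
  then have "hinner H y y = 0" using inner_self_eq[OF y] hnorm_square[OF y] by simp
  then have "y = 0" using inner_eq_zero[OF y] by simp
  then show ?thesis using x zero_closed by (simp add: hnorm_def)
next
  case False
  define c where "c = hinner H x y"
  define q where "q = (hnorm H y)\<^sup>2"
  have q: "0 < q" using False by (simp add: q_def)
  \<comment> \<open>\<open>a *\<^sub>C y\<close> is the orthogonal projection of \<open>x\<close>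
    onto the line through \<open>y\<close>, so the squared norm of \<open>x - a *\<^sub>C y\<close>
    is the gap in the inequality divided by \<open>q\<close>.\<close>
  define a where "a = c / of_real q"
  have "0 \<le> (hnorm H (x - a *\<^sub>C y))\<^sup>2" by simp
  also have "\<dots> = (hnorm H x)\<^sup>2 - 2 * Re (cnj a * c) + (cmod a)\<^sup>2 * q"
    using x y
    by (simp add: hnorm_diff_square hnorm_scaleC_square scaleC_closed inner_scaleC_right c_def q_def)
  also have "cnj a * c = of_real ((cmod c)\<^sup>2 / q)"
    using complex_norm_square[of c] by (simp add: a_def mult.commute)
  also have "(cmod a)\<^sup>2 * q = (cmod c)\<^sup>2 / q"
    using q by (simp add: a_def norm_divide power_divide power2_eq_square)
  finally have "(cmod c)\<^sup>2 / q \<le> (hnorm H x)\<^sup>2" by simp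
  then have "(cmod c)\<^sup>2 \<le> (hnorm H x * hnorm H y)\<^sup>2"
    using q by (simp add: q_def power_mult_distrib divide_le_eq)
  from power2_le_imp_le[OF this] show ?thesis
    using x y by (simp add: c_def hnorm_nonneg)
qed

lemma inner_right_unique:
  assumes "x \<in> hcarrier H" "y \<in> hcarrier H"
    and "\<And>u. u \<in> hcarrier H \<Longrightarrow> hinner H u x = hinner H u y"
  shows "x = y"
proof -
  have d: "x - y \<in> hcarrier H" using assms by (simp add: diff_closed)
  have "hinner H (x - y) (x - y) = 0"
    using assms d by (simp add: inner_diff_right)
  then show ?thesis using inner_eq_zero[OF d] by simp
qed

text \<open>A representing vector is unique, so any candidate with the adjoint property is the value
  of the definite description in \<open>hadj\<close>. Adjoints can thus be computed by exhibiting
  them.\<close>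

lemma hadj_eqI:
  assumes "x \<in> hcarrier H"
    and "\<And>u. u \<in> hcarrier H \<Longrightarrow> hinner K (T u) y = hinner H u x"
  shows "hadj H K T y = x"
  unfolding hadj_def
proof (rule the_equality)
  fix x' assume "x' \<in> hcarrier H \<and> (\<forall>u\<in>hcarrier H. hinner K (T u) y = hinner H u x')"
  then show "x' = x" using assms by (auto intro!: inner_right_unique)
qed (use assms in auto)

text \<open>The representing vector is the minimiser of \<open>\<parallel>u\<parallel>\<^sup>2 - 2 Re (\<phi> u)\<close>; minimising sequences are
  Cauchy by the parallelogram law.\<close>

lemma riesz:
  assumes add: "\<And>x y. x \<in> hcarrier H \<Longrightarrow> y \<in> hcarrier H \<Longrightarrow> \<phi> (x + y) = \<phi> x + \<phi> y"
    and scale: "\<And>a x. x \<in> hcarrier H \<Longrightarrow> \<phi> (a *\<^sub>C x) = a * \<phi> x"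
    and bound: "\<And>x. x \<in> hcarrier H \<Longrightarrow> cmod (\<phi> x) \<le> C * hnorm H x"
  obtains x where "x \<in> hcarrier H" "\<And>u. u \<in> hcarrier H \<Longrightarrow> \<phi> u = hinner H u x"
proof -
  define Q where "Q u = (hnorm H u)\<^sup>2 - 2 * Re (\<phi> u)" for u
  define m where "m = Inf (Q ` hcarrier H)"
  \<comment> \<open>Completing the square: \<open>Q u\<close> is at least
    \<open>(hnorm H u - C)\<^sup>2 - C\<^sup>2\<close>.\<close>
  have "- C\<^sup>2 \<le> Q u" if "u \<in> hcarrier H" for u
  proof -
    have "Re (\<phi> u) \<le> C * hnorm H u"
      using bound[OF that] complex_Re_le_cmod[of "\<phi> u"] by linarith
    moreover have "0 \<le> (hnorm H u - C)\<^sup>2" by simp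
    ultimately show ?thesis by (simp add: Q_def power2_diff mult.commute)
  qed
  then have bdd: "bdd_below (Q ` hcarrier H)" by (auto simp: bdd_below_def)
  have mle: "m \<le> Q u" if "u \<in> hcarrier H" for u
    unfolding m_def using that bdd by (auto intro: cInf_lower)
  have "\<exists>u\<in>hcarrier H. Q u < m + 1 / Suc n" for n :: nat
  proof -
    have "Q ` hcarrier H \<noteq> {}" using zero_closed by auto
    then have "\<exists>y\<in>Q ` hcarrier H. y < m + 1 / Suc n"
      unfolding m_def by (intro cInf_lessD) auto
    then show ?thesis by auto
  qed
  then obtain s where s: "\<And>n. s n \<in> hcarrier H" and sQ: "\<And>n. Q (s n) < m + 1 / real (Suc n)"
    by metis
  \<comment> \<open>The parallelogram law written in terms of \<open>Q\<close>: the contributions of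
    \<open>\<phi>\<close> cancel because it is additive and the last term is taken at the
    midpoint.\<close>
  have par: "(hnorm H (u - v))\<^sup>2 = 2 * Q u + 2 * Q v - 4 * Q ((1/2) *\<^sub>C (u + v))"
    if "u \<in> hcarrier H" "v \<in> hcarrier H" for u v
  proof -
    have "Re (\<phi> ((1/2) *\<^sub>C (u + v))) = (Re (\<phi> u) + Re (\<phi> v)) / 2" using that by (simp add: scale add add_closed)
    moreover have "(hnorm H ((1/2) *\<^sub>C (u + v)))\<^sup>2 = (hnorm H (u + v))\<^sup>2 / 4"
      using that hnorm_scaleC_square[of "u + v" "1/2"] add_closed
      by (simp add: norm_divide power_divide)
    ultimately show ?thesis
      using that by (simp add: Q_def hnorm_add_square hnorm_diff_square)
  qed
  have "\<exists>N. \<forall>k\<ge>N. \<forall>n\<ge>N. hnorm H (s k - s n) < e" if e: "e > 0" for e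
  proof -
    \<comment> \<open>By \<open>par\<close> and minimality of \<open>m\<close>, two terms of index
      at least \<open>N\<close> have squared distance below \<open>4 / Suc N\<close>, hence the
      bound \<open>e\<^sup>2 / 4\<close>.\<close>
    obtain N where N: "1 / real (Suc N) < e\<^sup>2 / 4"
      using reals_Archimedean[of "e\<^sup>2 / 4"] e by (auto simp: inverse_eq_divide)
    have "hnorm H (s k - s n) < e" if kn: "k \<ge> N" "n \<ge> N" for k n
    proof -
      have le: "1 / real (Suc i) \<le> 1 / real (Suc N)" if "i \<ge> N" for i
        using that by (simp add: frac_le)
      have "m \<le> Q ((1/2) *\<^sub>C (s k + s n))" by (intro mle scaleC_closed add_closed s)
      then have "(hnorm H (s k - s n))\<^sup>2 < e\<^sup>2"
        using par[OF s s, of k n] sQ[of k] sQ[of n] le[OF kn(1)] le[OF kn(2)] N by linarith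
      from power2_less_imp_less[OF this] show ?thesis using e by simp
    qed
    then show ?thesis by blast
  qed
  from complete[OF s this] obtain x where x: "x \<in> hcarrier H"
    and lim: "(\<lambda>n. hnorm H (s n - x)) \<longlonglongrightarrow> 0" by auto
  have inner_lim: "(\<lambda>n. hinner H u (s n)) \<longlonglongrightarrow> hinner H u x" if u: "u \<in> hcarrier H" for u
  proof (rule LIM_zero_cancel, rule Lim_null_comparison)
    show "\<forall>\<^sub>F n in sequentially. norm (hinner H u (s n) - hinner H u x) \<le> hnorm H u * hnorm H (s n - x)"
      using cauchy_schwarz[OF u diff_closed[OF s x]] u s x by (auto simp: inner_diff_right)
    show "(\<lambda>n. hnorm H u * hnorm H (s n - x)) \<longlonglongrightarrow> 0"
      using tendsto_mult_left[OF lim, of "hnorm H u"] by simp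
  qed
  have Re_eq: "Re (hinner H u x) = Re (\<phi> u)" if u: "u \<in> hcarrier H" for u
  proof -
    \<comment> \<open>Perturbing the almost minimal \<open>s n\<close> by \<open>t\<close> times
      \<open>u\<close> lowers \<open>Q\<close> by less than \<open>1 / Suc n\<close>. The limit is
      taken in this inequality, where \<open>s n\<close> occurs only inside an inner product with
      the fixed \<open>u\<close>; no continuity of \<open>Q\<close> or \<open>\<phi>\<close>
      enters.\<close>
    have "0 \<le> 2 * t * (Re (hinner H u x) - Re (\<phi> u)) + t\<^sup>2 * (hnorm H u)\<^sup>2" for t
    proof (rule LIMSEQ_le[OF tendsto_minus[OF LIMSEQ_Suc[OF lim_1_over_n]], simplified])
      show "(\<lambda>n. 2 * t * (Re (hinner H u (s n)) - Re (\<phi> u)) + t\<^sup>2 * (hnorm H u)\<^sup>2)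
          \<longlonglongrightarrow> 2 * t * (Re (hinner H u x) - Re (\<phi> u)) + t\<^sup>2 * (hnorm H u)\<^sup>2"
        by (intro tendsto_intros inner_lim u)
      have "- (1 / real (Suc n)) \<le> 2 * t * (Re (hinner H u (s n)) - Re (\<phi> u)) + t\<^sup>2 * (hnorm H u)\<^sup>2" for n
      proof -
        have "m \<le> Q (s n + of_real t *\<^sub>C u)" by (intro mle add_closed scaleC_closed s u)
        also have "\<dots> = Q (s n) + 2 * t * (Re (hinner H u (s n)) - Re (\<phi> u)) + t\<^sup>2 * (hnorm H u)\<^sup>2"
          using u s[of n] Re_inner_commute[OF u s[of n]]
          by (simp add: Q_def hnorm_add_square scaleC_closed hnorm_scaleC_square add scale
              inner_scaleC_right algebra_simps)
        finally show ?thesis using sQ[of n] by linarith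
      qed
      then show "\<exists>N. \<forall>n\<ge>N. - (1 / (1 + real n)) \<le> 2 * t * (Re (hinner H u (s n)) - Re (\<phi> u)) + t\<^sup>2 * (hnorm H u)\<^sup>2"
        by simp
    qed
    from quadratic_nonneg_imp_zero[OF this] show ?thesis by simp
  qed
  have "\<phi> u = hinner H u x" if u: "u \<in> hcarrier H" for u
  proof (rule complex_eqI)
    show "Re (\<phi> u) = Re (hinner H u x)" using Re_eq[OF u] by simp
    \<comment> \<open>Multiplying by \<open>\<i>\<close> turns imaginary parts into real parts up to
      sign, on both sides alike.\<close>
    have "Re (hinner H (\<i> *\<^sub>C u) x) = Re (\<phi> (\<i> *\<^sub>C u))" by (intro Re_eq scaleC_closed u)
    then show "Im (\<phi> u) = Im (hinner H u x)" using u x by (simp add: scale inner_scaleC_left)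
  qed
  with x show ?thesis by (rule that)
qed

text \<open>Existence of the adjoint: by Cauchy-Schwarz in \<open>K\<close> the functional sending
  \<open>u\<close> to \<open>hinner K (T u) y\<close> is bounded by \<open>C * hnorm K y\<close>, so
  \<open>riesz\<close> represents it.\<close>

lemma hadj_bounded_op:
  assumes K: "hilbert_space K" and T: "bounded_op H K T" and y: "y \<in> hcarrier K"
  shows hadj_closed: "hadj H K T y \<in> hcarrier H"
    and inner_hadj: "u \<in> hcarrier H \<Longrightarrow> hinner H u (hadj H K T y) = hinner K (T u) y"
proof -
  interpret K: hilbert_space K by fact
  obtain C where C: "\<And>x. x \<in> hcarrier H \<Longrightarrow> hnorm K (T x) \<le> C * hnorm H x"
    using T unfolding bounded_op_def by meson
  have Tc: "\<And>x. x \<in> hcarrier H \<Longrightarrow> T x \<in> hcarrier K" using T by (auto simp: bounded_op_def)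
  obtain x where x: "x \<in> hcarrier H" "\<And>u. u \<in> hcarrier H \<Longrightarrow> hinner K (T u) y = hinner H u x"
  proof (rule riesz[where \<phi> = "\<lambda>u. hinner K (T u) y" and C = "C * hnorm K y"])
    fix x assume x: "x \<in> hcarrier H"
    have "cmod (hinner K (T x) y) \<le> hnorm K (T x) * hnorm K y"
      by (intro K.cauchy_schwarz Tc x y)
    also have "\<dots> \<le> (C * hnorm H x) * hnorm K y"
      by (intro mult_right_mono C x K.hnorm_nonneg y)
    finally show "cmod (hinner K (T x) y) \<le> C * hnorm K y * hnorm H x"
      by (simp add: mult_ac)
  qed (use T y in \<open>auto simp: bounded_op_def K.inner_add_left K.inner_scaleC_left\<close>)
  have "hadj H K T y = x" using x by (rule hadj_eqI)
  then show "hadj H K T y \<in> hcarrier H"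
    and "u \<in> hcarrier H \<Longrightarrow> hinner H u (hadj H K T y) = hinner K (T u) y"
    using x by auto
qed

end

section \<open>Tuples in a Hilbert space and adjoints of row operators\<close>

lemma hcarrier_htuple: "F \<in> hcarrier (htuple H) \<longleftrightarrow> (\<forall>j. F j \<in> hcarrier H)"
  by (simp add: htuple_def)

lemma hinner_htuple: "hinner (htuple H) F G = (\<Sum>j\<in>UNIV. hinner H (F j) (G j))"
  by (simp add: htuple_def)

text \<open>Completeness goes coordinate by coordinate: each coordinate norm is dominated by the
  tuple norm, so coordinates of a Cauchy sequence converge, and the finite sum of squared coordinate
  distances then tends to 0.\<close>

lemma hilbert_space_htuple:
  assumes "hilbert_space H"
  shows "hilbert_space (htuple H :: ('d::finite \<Rightarrow> 'a::complex_vector) hspace)"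
proof -
  interpret hilbert_space H by fact
  let ?T = "htuple H :: ('d \<Rightarrow> 'a) hspace"
  have norm_T: "hnorm ?T F = sqrt (\<Sum>j\<in>UNIV. (hnorm H (F j))\<^sup>2)" if "\<And>j. F j \<in> hcarrier H" for F
    using that by (simp add: hnorm_def[of ?T] hinner_htuple hnorm_square)
  show ?thesis
  proof
    fix F G :: "'d \<Rightarrow> 'a"
    assume F: "F \<in> hcarrier ?T" and G: "G \<in> hcarrier ?T"
    have "hinner H (F j) (G j) = cnj (hinner H (G j) (F j))" for j
      using F G by (intro inner_commute) (auto simp: hcarrier_htuple)
    then show "hinner ?T F G = cnj (hinner ?T G F)"
      by (simp add: hinner_htuple)
  next
    fix F :: "'d \<Rightarrow> 'a"
    assume F: "F \<in> hcarrier ?T" and 0: "hinner ?T F F = 0"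
    from 0 have "(\<Sum>j\<in>UNIV. Re (hinner H (F j) (F j))) = 0"
      by (metis Re_sum hinner_htuple zero_complex.sel(1))
    then have "Re (hinner H (F j) (F j)) = 0" for j
      using F by (subst (asm) sum_nonneg_eq_0_iff) (auto simp: hcarrier_htuple inner_nonneg)
    then have "hinner H (F j) (F j) = 0" for j
      using F inner_self_eq[of "F j"] by (simp add: hcarrier_htuple)
    then show "F = 0"
      using F by (auto simp: hcarrier_htuple fun_eq_iff intro: inner_eq_zero)
  next
    fix s :: "nat \<Rightarrow> 'd \<Rightarrow> 'a"
    assume s: "\<And>n. s n \<in> hcarrier ?T"
      and Cau: "\<And>e. e > 0 \<Longrightarrow> \<exists>N. \<forall>m\<ge>N. \<forall>n\<ge>N. hnorm ?T (s m - s n) < e"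
    have sj: "s n j \<in> hcarrier H" for n j using s by (simp add: hcarrier_htuple)
    have le: "hnorm H (s m j - s n j) \<le> hnorm ?T (s m - s n)" for m n j
      unfolding norm_T[of "s m - s n", simplified, OF diff_closed[OF sj sj]]
      by (rule real_le_rsqrt, rule member_le_sum[where f = "\<lambda>j. (hnorm H (s m j - s n j))\<^sup>2"]) auto
    have "\<exists>x\<in>hcarrier H. (\<lambda>n. hnorm H (s n j - x)) \<longlonglongrightarrow> 0" for j
    proof (rule complete)
      show "\<exists>N. \<forall>m\<ge>N. \<forall>n\<ge>N. hnorm H (s m j - s n j) < e" if "e > 0" for e
      proof -
        obtain N where "\<forall>m\<ge>N. \<forall>n\<ge>N. hnorm ?T (s m - s n) < e"
          using Cau[OF \<open>e > 0\<close>] by auto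
        then have "\<forall>m\<ge>N. \<forall>n\<ge>N. hnorm H (s m j - s n j) < e"
          by (auto intro: le_less_trans[OF le])
        then show ?thesis by (rule exI)
      qed
    qed (rule sj)
    then obtain F where F: "\<And>j. F j \<in> hcarrier H"
      and lim: "\<And>j. (\<lambda>n. hnorm H (s n j - F j)) \<longlonglongrightarrow> 0" by metis
    have "(\<lambda>n. sqrt (\<Sum>j\<in>UNIV. (hnorm H (s n j - F j))\<^sup>2)) \<longlonglongrightarrow> sqrt (\<Sum>j\<in>(UNIV::'d set). 0\<^sup>2)"
      by (intro tendsto_intros lim)
    then have "(\<lambda>n. hnorm ?T (s n - F)) \<longlonglongrightarrow> 0"
      by (simp add: norm_T diff_closed sj F)
    then show "\<exists>F\<in>hcarrier ?T. (\<lambda>n. hnorm ?T (s n - F)) \<longlonglongrightarrow> 0"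
      using F by (auto simp: hcarrier_htuple)
  qed (auto simp: hcarrier_htuple hinner_htuple zero_closed add_closed scaleC_closed scaleC_fun_def
      inner_add_left inner_scaleC_left sum.distrib sum_distrib_left intro!: sum_nonneg inner_nonneg)
qed

text \<open>The adjoint of a row is the column of adjoints. This links the Gleason identity, stated
  with the adjoints of the single \<open>X j\<close>, to extremality, stated with the adjoint of the
  whole row.\<close>

lemma hadj_row_op_component:
  fixes X :: "'d::finite \<Rightarrow> 'a::complex_vector \<Rightarrow> 'a"
  assumes H: "hilbert_space H" and X: "row_contraction H X" and f: "f \<in> hcarrier H"
  shows "hadj H H (X j) f = hadj (htuple H) H (row_op X) f j"
proof -
  interpret hilbert_space H by fact
  interpret T: hilbert_space "htuple H :: ('d \<Rightarrow> 'a) hspace" using H by (rule hilbert_space_htuple)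
  let ?G = "hadj (htuple H) H (row_op X) f"
  have B: "bounded_op (htuple H) H (row_op X)"
    using X by (simp add: row_contraction_def contractive_op_def)
  have G: "?G \<in> hcarrier (htuple H)" by (rule T.hadj_closed[OF H B f])
  \<comment> \<open>Homogeneity with scalar 0 gives the value at 0, which removes all but one
    summand of the row below.\<close>
  have X0: "X i 0 = 0" for i
  proof -
    have "X i (0 *\<^sub>C 0) = 0 *\<^sub>C X i 0"
      using X zero_closed unfolding row_contraction_def bounded_op_def by blast
    then show ?thesis by simp
  qed
  show ?thesis
  proof (rule hadj_eqI)
    show "?G j \<in> hcarrier H" using G by (simp add: hcarrier_htuple)
    fix u assume u: "u \<in> hcarrier H"
    \<comment> \<open>Tuples supported in the single coordinate \<open>j\<close> isolate the
      component \<open>j\<close> of the row adjoint.\<close>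
    define U where "U i = (if i = j then u else 0)" for i
    have U: "U \<in> hcarrier (htuple H)" using u zero_closed by (simp add: hcarrier_htuple U_def)
    have "X i (U i) = (if i = j then X j u else 0)" for i by (simp add: U_def X0)
    then have "row_op X U = X j u" by (simp add: row_op_def)
    moreover have "hinner H (U i) (?G i) = (if i = j then hinner H u (?G j) else 0)" for i
      using G by (simp add: U_def hcarrier_htuple)
    then have "hinner (htuple H) U ?G = hinner H u (?G j)" by (simp add: hinner_htuple)
    ultimately show "hinner H (X j u) f = hinner H u (?G j)"
      using T.inner_hadj[OF H B f U] by simp
  qed
qed

section \<open>The kernel at the origin and the multiplication formula\<close>

lemma dBR_kernel_zero:
  assumes J: "hilbert_space J" and K: "hilbert_space K"
    and bz: "bounded_op J K (b z)" and b0: "\<forall>u\<in>hcarrier J. b 0 u = 0" and x: "x \<in> hcarrier K"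
  shows "dBR_kernel J K b z 0 x = x"
proof -
  interpret J: hilbert_space J by fact
  interpret K: hilbert_space K by fact
  \<comment> \<open>As \<open>b 0\<close> vanishes on the carrier of \<open>J\<close>, the zero
    vector has the adjoint property.\<close>
  have "hadj J K (b 0) x = 0"
    by (rule J.hadj_eqI) (use b0 x J.zero_closed in auto)
  moreover have "b z (0 *\<^sub>C 0) = 0 *\<^sub>C b z 0"
    using bz J.zero_closed unfolding bounded_op_def by blast
  ultimately show ?thesis by (simp add: dBR_kernel_def herm_def scaleC_one)
qed

theorem corollary4p15:
  fixes J :: "'j::complex_vector hspace" and K :: "'k::complex_vector hspace"
    and b :: "complex ^ 'd::finite \<Rightarrow> 'j \<Rightarrow> 'k"
    and H :: "(complex ^ 'd \<Rightarrow> 'k) hspace"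
    and X :: "'d \<Rightarrow> (complex ^ 'd \<Rightarrow> 'k) \<Rightarrow> complex ^ 'd \<Rightarrow> 'k"
  assumes "hilbert_space J" "hseparable J"
    and "hilbert_space K" "hseparable K"
    and "schur_class J K b"
    and "\<forall>x\<in>hcarrier J. b 0 x = 0"
    and "is_dBR_space J K b H"
    and "extremal_gleason_solution K H X"
  shows "partial_isometry (htuple H) H (row_op X) \<and>
    (\<forall>f\<in>hperp (htuple H) (hker (htuple H) (row_op X)). \<forall>z\<in>\<bool>.
      row_op X f z = (\<Sum>j\<in>UNIV. z $ j *\<^sub>C f j z))"
proof -
  interpret K: hilbert_space K by fact
  have rk: "is_rkhs K (dBR_kernel J K b) H" using assms(7) by (simp add: is_dBR_space_def)
  then have H: "hilbert_space H" by (simp add: is_rkhs_def)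
  interpret H: hilbert_space H by fact
  interpret T: hilbert_space "htuple H :: ('d \<Rightarrow> complex ^ 'd \<Rightarrow> 'k) hspace"
    using H by (rule hilbert_space_htuple)
  have ball0: "(0::complex^'d) \<in> \<bool>" by simp
  \<comment> \<open>The constant function with value \<open>x\<close>, cut off outside the ball
    because elements of \<open>H\<close> are represented by their extension by zero.\<close>
  define c where "c x = on_ball (\<lambda>z::complex^'d. x)" for x :: 'k
  have c_ker: "on_ball (\<lambda>z. dBR_kernel J K b z 0 x) = c x" if "x \<in> hcarrier K" for x
  proof -
    have "bounded_op J K (b z)" if "z \<in> \<bool>" for z
      using assms(5) that by (auto simp: schur_class_def)
    from dBR_kernel_zero[where b = b, OF assms(1,3) this assms(6) that] show ?thesis
      by (auto simp: c_def on_ball_def fun_eq_iff)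
  qed
  have c: "c x \<in> hcarrier H" and inner_c: "\<And>f. f \<in> hcarrier H \<Longrightarrow> hinner H f (c x) = hinner K (f 0) x"
    if "x \<in> hcarrier K" for x
    using rk ball0 that c_ker[OF that] unfolding is_rkhs_def by metis+
  have val: "f z \<in> hcarrier K" if "f \<in> hcarrier H" "z \<in> \<bool>" for f z
    using rk that unfolding is_rkhs_def by blast
  have val0: "f 0 \<in> hcarrier K" if "f \<in> hcarrier H" for f using val[OF that ball0] .
  have k0: "kernel_op K H 0 x = c x" if "x \<in> hcarrier K" for x
    unfolding kernel_op_def by (rule H.hadj_eqI) (use c inner_c that in auto)
  \<comment> \<open>\<open>kernel_op K H 0\<close> is the adjoint of evaluation at 0, so its own
    adjoint is evaluation again; the reproducing property verifies this directly.\<close>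
  have k0_adj: "hadj K H (kernel_op K H 0) f = f 0" if f: "f \<in> hcarrier H" for f
  proof (rule K.hadj_eqI)
    fix u assume u: "u \<in> hcarrier K"
    show "hinner H (kernel_op K H 0 u) f = hinner K u (f 0)"
      using k0[OF u] inner_c[OF u f] H.inner_commute[OF c[OF u] f] K.inner_commute[OF u val0[OF f]]
      by simp
  qed (use val0[OF f] in auto)
  define A where "A f = hadj (htuple H) H (row_op X) f" for f
  have RC: "row_contraction H X"
    and gl: "\<And>f z. f \<in> hcarrier H \<Longrightarrow> z \<in> \<bool> \<Longrightarrow> (\<Sum>j\<in>UNIV. z $ j *\<^sub>C hadj H H (X j) f z) = f z - f 0"
    and ext: "\<And>f. f \<in> hcarrier H \<Longrightarrow> row_op X (A f) = f - kernel_op K H 0 (hadj K H (kernel_op K H 0) f)"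
    using assms(8) by (auto simp: extremal_gleason_solution_def gleason_solution_def A_def)
  have XA: "row_op X (A f) = f - c (f 0)" if "f \<in> hcarrier H" for f
    using ext[OF that] by (simp add: that k0_adj k0 val0)
  have B: "bounded_op (htuple H) H (row_op X)"
    using RC by (simp add: row_contraction_def contractive_op_def)
  have X: "row_op X F \<in> hcarrier H" if "F \<in> hcarrier (htuple H)" for F
    using B that by (auto simp: bounded_op_def)
  have A: "A f \<in> hcarrier (htuple H)" if "f \<in> hcarrier H" for f
    unfolding A_def by (rule T.hadj_closed[OF H B that])
  have inner_A: "hinner (htuple H) F (A f) = hinner H (row_op X F) f"
    if "F \<in> hcarrier (htuple H)" "f \<in> hcarrier H" for F f
    unfolding A_def by (rule T.inner_hadj[OF H B that(2,1)])
  have X_diff: "row_op X (F - G) = row_op X F - row_op X G"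
    if "F \<in> hcarrier (htuple H)" "G \<in> hcarrier (htuple H)" for F G
  proof -
    have "row_op X ((F - G) + G) = row_op X (F - G) + row_op X G"
      using B that T.diff_closed[OF that] unfolding bounded_op_def by blast
    then show ?thesis by simp
  qed
  have A_c: "A (c x) = 0" if x: "x \<in> hcarrier K" for x
  proof (rule T.inner_eq_zero)
    show "A (c x) \<in> hcarrier (htuple H)" using x by (intro A c)
    have "c x 0 = x" by (simp add: c_def on_ball_def)
    \<comment> \<open>\<open>c x\<close> equals its own constant part, so \<open>XA\<close>
      annihilates it; the squared norm of \<open>A (c x)\<close> is then the inner product of 0 with
      \<open>c x\<close>.\<close>
    then have "row_op X (A (c x)) = 0" using XA[OF c[OF x]] by simp
    then show "hinner (htuple H) (A (c x)) (A (c x)) = 0"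
      using x by (simp add: inner_A A c)
  qed
  have XF0: "row_op X F 0 = 0" if F: "F \<in> hcarrier (htuple H)" for F
  proof (rule K.inner_eq_zero)
    show v: "row_op X F 0 \<in> hcarrier K" using F by (intro val0 X)
    \<comment> \<open>The value at 0 is paired with itself: the reproducing property moves it to
      \<open>H\<close> as a pairing with a constant, and the adjoint moves it on to a pairing with
      \<open>A\<close> of that constant, which is 0.\<close>
    have "hinner K (row_op X F 0) (row_op X F 0) = hinner (htuple H) F (A (c (row_op X F 0)))"
      using F v by (simp add: inner_A c inner_c X)
    then show "hinner K (row_op X F 0) (row_op X F 0) = 0"
      using F v by (simp add: A_c)
  qed
  have XAX: "row_op X (A (row_op X F)) = row_op X F" if "F \<in> hcarrier (htuple H)" for F
    using XA[OF X[OF that]] XF0[OF that] by (simp add: c_def on_ball_def fun_eq_iff)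
  have AX: "A (row_op X F) = F" if "F \<in> hperp (htuple H) (hker (htuple H) (row_op X))" for F
  proof -
    have F: "F \<in> hcarrier (htuple H)" using that by (simp add: hperp_def)
    \<comment> \<open>\<open>G\<close> is the defect of \<open>F\<close> under
      \<open>X\<^sup>* X\<close>. By \<open>XAX\<close> it lies in the kernel of the row, hence is
      orthogonal to \<open>F\<close>; it is also orthogonal to the range of \<open>A\<close>. Being
      a difference of two such vectors, it is orthogonal to itself.\<close>
    define G where "G = F - A (row_op X F)"
    have G: "G \<in> hcarrier (htuple H)" unfolding G_def by (intro T.diff_closed F A X)
    have XG: "row_op X G = 0" unfolding G_def by (simp add: X_diff F A X XAX)
    have FG: "hinner (htuple H) F G = 0" using that G XG by (simp add: hperp_def hker_def)
    have "hinner (htuple H) G (A (row_op X F)) = 0" by (simp add: inner_A G F X XG)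
    then have "hinner (htuple H) G G = 0"
      using FG T.inner_commute[OF G F] T.inner_diff_right[OF F A[OF X[OF F]] G]
      by (simp add: G_def)
    then show ?thesis using T.inner_eq_zero[OF G] by (simp add: G_def)
  qed
  have iso: "hnorm H (row_op X F) = hnorm (htuple H) F"
    if "F \<in> hperp (htuple H) (hker (htuple H) (row_op X))" for F
  proof -
    have F: "F \<in> hcarrier (htuple H)" using that by (simp add: hperp_def)
    show ?thesis using inner_A[OF F X[OF F]] AX[OF that] by (simp add: hnorm_def)
  qed
  have mult: "row_op X F z = (\<Sum>j\<in>UNIV. z $ j *\<^sub>C F j z)"
    if "F \<in> hperp (htuple H) (hker (htuple H) (row_op X))" "z \<in> \<bool>" for F z
  proof -
    have F: "F \<in> hcarrier (htuple H)" using that by (simp add: hperp_def)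
    \<comment> \<open>Component \<open>j\<close> of \<open>AX\<close>; the Gleason identity at
      \<open>row_op X F\<close> then has no constant term by \<open>XF0\<close>.\<close>
    have "hadj H H (X j) (row_op X F) = F j" for j
      using hadj_row_op_component[OF H RC X[OF F]] AX[OF that(1)] by (simp add: A_def)
    then show ?thesis using gl[OF X[OF F] that(2)] by (simp add: XF0 F)
  qed
  show ?thesis using B iso mult by (auto simp: partial_isometry_def)
qed

end
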